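(* Let $(L,[-,-],R,d)$ be a Reynolds LieDer pair and $(V;\rho,R_V,d_V)$ a representation of it. Then $\{\oplus_{n\ge1}\mathfrak{C}^n_{\mathrm{RLieDer}}(L;V),\mathfrak{D}_{\mathrm{RLieDer}}\}$ is a cochain complex, i.e. $$\mathfrak{D}_{\mathrm{RLieDer}}\circ\mathfrak{D}_{\mathrm{RLieDer}}=0.$$
   Context: All vector spaces are over a fixed ground field. A Reynolds operator on a Lie algebra $(L,[-,-])$ is a linear map $R:L\to L$ with $[Rx,Ry]=R([Rx,y]+[x,Ry]-[Rx,Ry])$. A Reynolds LieDer pair $(L,[-,-],R,d)$ is a Lie algebra with a Reynolds operator $R$ and a derivation $d:L\to L$ such that $R\circ d=d\circ R$. A representation of it is $(V;\rho,R_V,d_V)$ where $\rho:L\to\mathrm{gl}(V)$ is a representation of the Lie algebra $L$ and $R_V,d_V:V\to V$ are linear maps such that $\rho(Rx)R_V(u)=R_V(\rho(Rx)u+\rho(x)R_V(u)-\rho(Rx)R_V(u))$, $d_V\rho(x)u=\rho(dx)u+\rho(x)d_V(u)$, and $R_V\circ d_V=d_V\circ R_V$. On $C^n=\mathrm{Hom}(\wedge^nL,V)$ ($C^0=V$) put $$(\delta_{CE}f)(x_1,\dots,x_{n+1})=\sum_{i=1}^{n+1}(-1)^{i+n}\rho(x_i)f(x_1,\dots,\hat x_i,\dots,x_{n+1})+\sum_{1\le i<j\le n+1}(-1)^{i+j+n+1}f([x_i,x_j],x_1,\dots,\hat x_i,\dots,\hat x_j,\dots,x_{n+1}),$$ and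 let $\delta_R$ be given by the same formula with $[-,-]$ replaced by the Lie bracket $[x,y]_R=[x,Ry]+[Rx,y]-[Rx,Ry]$ and $\rho$ by its representation $\rho_R(x)u=\rho(Rx)u+R_V(\rho(Rx)u-\rho(x)u)$. For $n\ge1$, $$(\varphi f)(x_1,\dots,x_n)=f(Rx_1,\dots,Rx_n)-R_V\sum_{i=1}^n f(Rx_1,\dots,Rx_{i-1},x_i,Rx_{i+1},\dots,Rx_n)+(n-1)R_Vf(Rx_1,\dots,Rx_n),$$ $$(\Delta f)(x_1,\dots,x_n)=\sum_{i=1}^nf(x_1,\dots,dx_i,\dots,x_n)-d_V(f(x_1,\dots,x_n)),$$ and $\Delta=-d_V$ on $C^0=V$. For $n\ge1$ let $C^n_R(L;V)=C^n\oplus C^{n-1}$, $D_R(f,g)=(\delta_{CE}f,\,-\delta_Rg-\varphi f)\in C^{n+1}_R(L;V)$, and $\Delta(f,g)=(\Delta f,\Delta g)$. Set $\mathfrak{C}^1_{\mathrm{RLieDer}}(L;V)=C^1_R(L;V)$ and $\mathfrak{C}^n_{\mathrm{RLieDer}}(L;V)=C^n_R(L;V)\times C^{n-1}_R(L;V)$ for $n\ge2$. The map $\mathfrak{D}_{\mathrm{RLieDer}}:\mathfrak{C}^n_{\mathrm{RLieDer}}(L;V)\to\mathfrak{C}^{n+1}_{\mathrm{RLieDer}}(L;V)$ is $\mathfrak{D}_{\mathrm{RLieDer}}(f)=(D_R(f),-\Delta f)$ for $n=1$, $f\in C^1_R(L;V)$, and, for $n\ge2$, $$\mathfrak{D}_{\mathrm{RLieDer}}((f,g),(\tilde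 f,\tilde g))=(D_R(f,g),\,D_R(\tilde f,\tilde g)+(-1)^n\Delta(f,g)).$$ *)

theory Defs
  imports Complex_Main "HOL-Library.Function_Algebras" "HOL-Library.Product_Plus"
begin

locale lie_algebra = vector_space scale
  for scale :: "'k::field \<Rightarrow> 'l::ab_group_add \<Rightarrow> 'l" +
  fixes br :: "'l \<Rightarrow> 'l \<Rightarrow> 'l"
  assumes br_linear_right: "Vector_Spaces.linear scale scale (\<lambda>y. br x y)"
    and br_linear_left: "Vector_Spaces.linear scale scale (\<lambda>x. br x y)"
    and br_self: "br x x = 0"
    and jacobi: "br x (br y z) + br y (br z x) + br z (br x y) = 0"

locale lie_representation =
  lie_algebra scaleL br + V: vector_space scaleV
  for scaleL :: "'k::field \<Rightarrow> 'l::ab_group_add \<Rightarrow> 'l"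
    and br :: "'l \<Rightarrow> 'l \<Rightarrow> 'l"
    and scaleV :: "'k \<Rightarrow> 'v::ab_group_add \<Rightarrow> 'v" +
  fixes rho :: "'l \<Rightarrow> 'v \<Rightarrow> 'v"
  assumes rho_endo: "Vector_Spaces.linear scaleV scaleV (rho x)"
    and rho_linear: "Vector_Spaces.linear scaleL scaleV (\<lambda>x. rho x u)"
    and rho_br: "rho (br x y) u = rho x (rho y u) - rho y (rho x u)"

locale reynolds_lieder_pair = lie_algebra scale br
  for scale :: "'k::field \<Rightarrow> 'l::ab_group_add \<Rightarrow> 'l"
    and br :: "'l \<Rightarrow> 'l \<Rightarrow> 'l" +
  fixes R d :: "'l \<Rightarrow> 'l"
  assumes R_linear: "Vector_Spaces.linear scale scale R"
    and reynolds: "br (R x) (R y) = R (br (R x) y + br x (R y) - br (R x) (R y))"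
    and d_linear: "Vector_Spaces.linear scale scale d"
    and derivation: "d (br x y) = br (d x) y + br x (d y)"
    and R_d_commute: "R \<circ> d = d \<circ> R"

locale reynolds_lieder_representation =
  reynolds_lieder_pair scaleL br R d + lie_representation scaleL br scaleV rho
  for scaleL :: "'k::field \<Rightarrow> 'l::ab_group_add \<Rightarrow> 'l"
    and br :: "'l \<Rightarrow> 'l \<Rightarrow> 'l"
    and R d :: "'l \<Rightarrow> 'l"
    and scaleV :: "'k \<Rightarrow> 'v::ab_group_add \<Rightarrow> 'v"
    and rho :: "'l \<Rightarrow> 'v \<Rightarrow> 'v" +
  fixes RV dV :: "'v \<Rightarrow> 'v"
  assumes RV_linear: "Vector_Spaces.linear scaleV scaleV RV"
    and RV_reynolds:
      "rho (R x) (RV u) = RV (rho (R x) u + rho x (RV u) - rho (R x) (RV u))"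
    and dV_linear: "Vector_Spaces.linear scaleV scaleV dV"
    and dV_rho: "dV (rho x u) = rho (d x) u + rho x (dV u)"
    and RV_dV_commute: "RV \<circ> dV = dV \<circ> RV"

text \<open>
  The space Hom(\<open>\<And>\<^sup>n L\<close>, V) is realised as the alternating \<open>n\<close>-linear maps. A tuple in \<open>L\<^sup>n\<close>
  is a list of length \<open>n\<close>; a cochain of degree \<open>n\<close> is extended by 0 to lists of other lengths,
  so that it is determined by its values on \<open>L\<^sup>n\<close>. In degree 0 such a map is given by its value
  at the empty list, i.e. by an element of \<open>V\<close>.
\<close>

definition cochains ::
  "('k::field \<Rightarrow> 'l::ab_group_add \<Rightarrow> 'l) \<Rightarrow> ('k \<Rightarrow> 'v::ab_group_add \<Rightarrow> 'v) \<Rightarrow> nat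
    \<Rightarrow> ('l list \<Rightarrow> 'v) set" where
  "cochains scaleL scaleV n =
    {f. (\<forall>xs i. length xs = n \<and> i < n \<longrightarrow>
            Vector_Spaces.linear scaleL scaleV (\<lambda>x. f (xs[i := x])))
      \<and> (\<forall>xs i j. length xs = n \<and> i < j \<and> j < n \<and> xs ! i = xs ! j \<longrightarrow> f xs = 0)
      \<and> (\<forall>xs. length xs \<noteq> n \<longrightarrow> f xs = 0)}"

definition omit :: "nat \<Rightarrow> 'a list \<Rightarrow> 'a list" where
  "omit i xs = take i xs @ drop (Suc i) xs"

text \<open>
  List positions start at 0, so the \<open>i\<close>-th argument \<open>x\<^sub>i\<close> of the usual formula sits at position
  \<open>i - 1\<close>; this is the reason for \<open>Suc i\<close> and \<open>Suc j\<close> in the signs. The argument \<open>n\<close> is the degree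
  of the cochain \<open>f\<close>.
\<close>

definition delta_CE ::
  "('k::field \<Rightarrow> 'v::ab_group_add \<Rightarrow> 'v) \<Rightarrow> ('l \<Rightarrow> 'l \<Rightarrow> 'l) \<Rightarrow> ('l \<Rightarrow> 'v \<Rightarrow> 'v) \<Rightarrow> nat
    \<Rightarrow> ('l list \<Rightarrow> 'v) \<Rightarrow> 'l list \<Rightarrow> 'v" where
  "delta_CE scaleV br rho n f xs =
    (if length xs = n + 1 then
       (\<Sum>i<n + 1. scaleV ((-1) ^ (Suc i + n)) (rho (xs ! i) (f (omit i xs))))
     + (\<Sum>j<n + 1. \<Sum>i<j. scaleV ((-1) ^ (Suc i + Suc j + n + 1))
          (f (br (xs ! i) (xs ! j) # omit i (omit j xs))))
     else 0)"

definition bracket_R ::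
  "('l::ab_group_add \<Rightarrow> 'l \<Rightarrow> 'l) \<Rightarrow> ('l \<Rightarrow> 'l) \<Rightarrow> 'l \<Rightarrow> 'l \<Rightarrow> 'l" where
  "bracket_R br R x y = br x (R y) + br (R x) y - br (R x) (R y)"

definition rho_R ::
  "('l \<Rightarrow> 'v::ab_group_add \<Rightarrow> 'v) \<Rightarrow> ('l \<Rightarrow> 'l) \<Rightarrow> ('v \<Rightarrow> 'v) \<Rightarrow> 'l \<Rightarrow> 'v \<Rightarrow> 'v" where
  "rho_R rho R RV x u = rho (R x) u + RV (rho (R x) u - rho x u)"

definition delta_R ::
  "('k::field \<Rightarrow> 'v::ab_group_add \<Rightarrow> 'v) \<Rightarrow> ('l::ab_group_add \<Rightarrow> 'l \<Rightarrow> 'l) \<Rightarrow> ('l \<Rightarrow> 'l)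
    \<Rightarrow> ('l \<Rightarrow> 'v \<Rightarrow> 'v) \<Rightarrow> ('v \<Rightarrow> 'v) \<Rightarrow> nat \<Rightarrow> ('l list \<Rightarrow> 'v) \<Rightarrow> 'l list \<Rightarrow> 'v" where
  "delta_R scaleV br R rho RV = delta_CE scaleV (bracket_R br R) (rho_R rho R RV)"

text \<open>Only used in degrees \<open>n \<ge> 1\<close>, where the truncated subtraction \<open>n - 1\<close> is harmless.\<close>

definition phi ::
  "('k::field \<Rightarrow> 'v::ab_group_add \<Rightarrow> 'v) \<Rightarrow> ('l \<Rightarrow> 'l) \<Rightarrow> ('v \<Rightarrow> 'v) \<Rightarrow> nat
    \<Rightarrow> ('l list \<Rightarrow> 'v) \<Rightarrow> 'l list \<Rightarrow> 'v" where
  "phi scaleV R RV n f xs =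
    (if length xs = n then
       f (map R xs) - RV (\<Sum>i<n. f ((map R xs)[i := xs ! i]))
     + scaleV (of_nat (n - 1)) (RV (f (map R xs)))
     else 0)"

text \<open>In degree 0 the sum is empty and the operator is \<open>- dV\<close> on \<open>V\<close>.\<close>

definition Delta ::
  "('l \<Rightarrow> 'l) \<Rightarrow> ('v::ab_group_add \<Rightarrow> 'v) \<Rightarrow> nat \<Rightarrow> ('l list \<Rightarrow> 'v) \<Rightarrow> 'l list \<Rightarrow> 'v" where
  "Delta d dV n f xs =
    (if length xs = n then (\<Sum>i<n. f (xs[i := d (xs ! i)])) - dV (f xs) else 0)"

text \<open>The complex of the Reynolds operator, in degrees \<open>n \<ge> 1\<close>.\<close>

type_synonym ('l, 'v) cochain_R = "('l list \<Rightarrow> 'v) \<times> ('l list \<Rightarrow> 'v)"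

definition cochains_R ::
  "('k::field \<Rightarrow> 'l::ab_group_add \<Rightarrow> 'l) \<Rightarrow> ('k \<Rightarrow> 'v::ab_group_add \<Rightarrow> 'v) \<Rightarrow> nat
    \<Rightarrow> ('l, 'v) cochain_R set" where
  "cochains_R scaleL scaleV n = cochains scaleL scaleV n \<times> cochains scaleL scaleV (n - 1)"

definition scale_R ::
  "('k \<Rightarrow> 'v \<Rightarrow> 'v) \<Rightarrow> 'k \<Rightarrow> ('l, 'v) cochain_R \<Rightarrow> ('l, 'v) cochain_R" where
  "scale_R scaleV c = (\<lambda>(f, g). (\<lambda>xs. scaleV c (f xs), \<lambda>xs. scaleV c (g xs)))"

definition D_R ::
  "('k::field \<Rightarrow> 'v::ab_group_add \<Rightarrow> 'v) \<Rightarrow> ('l::ab_group_add \<Rightarrow> 'l \<Rightarrow> 'l) \<Rightarrow> ('l \<Rightarrow> 'l)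
    \<Rightarrow> ('l \<Rightarrow> 'v \<Rightarrow> 'v) \<Rightarrow> ('v \<Rightarrow> 'v) \<Rightarrow> nat \<Rightarrow> ('l, 'v) cochain_R \<Rightarrow> ('l, 'v) cochain_R" where
  "D_R scaleV br R rho RV n = (\<lambda>(f, g).
    (delta_CE scaleV br rho n f,
     - delta_R scaleV br R rho RV (n - 1) g - phi scaleV R RV n f))"

definition Delta_R ::
  "('l \<Rightarrow> 'l) \<Rightarrow> ('v::ab_group_add \<Rightarrow> 'v) \<Rightarrow> nat
    \<Rightarrow> ('l, 'v) cochain_R \<Rightarrow> ('l, 'v) cochain_R" where
  "Delta_R d dV n = (\<lambda>(f, g). (Delta d dV n f, Delta d dV (n - 1) g))"

text \<open>
  The complex of the Reynolds LieDer pair, in degrees \<open>n \<ge> 1\<close>. So that all degrees live in one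
  type, the space in degree 1, which is \<open>cochains_R scaleL scaleV 1\<close>, is identified with its
  product with the zero space.
\<close>

type_synonym ('l, 'v) cochain_RLieDer = "('l, 'v) cochain_R \<times> ('l, 'v) cochain_R"

definition cochains_RLieDer ::
  "('k::field \<Rightarrow> 'l::ab_group_add \<Rightarrow> 'l) \<Rightarrow> ('k \<Rightarrow> 'v::ab_group_add \<Rightarrow> 'v) \<Rightarrow> nat
    \<Rightarrow> ('l, 'v) cochain_RLieDer set" where
  "cochains_RLieDer scaleL scaleV n =
    (if n = 1 then cochains_R scaleL scaleV 1 \<times> {0}
     else cochains_R scaleL scaleV n \<times> cochains_R scaleL scaleV (n - 1))"

definition scale_RLieDer ::
  "('k \<Rightarrow> 'v \<Rightarrow> 'v) \<Rightarrow> 'k \<Rightarrow> ('l, 'v) cochain_RLieDer \<Rightarrow> ('l, 'v) cochain_RLieDer" where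
  "scale_RLieDer scaleV c = (\<lambda>(p, q). (scale_R scaleV c p, scale_R scaleV c q))"

definition D_RLieDer ::
  "('k::field \<Rightarrow> 'v::ab_group_add \<Rightarrow> 'v) \<Rightarrow> ('l::ab_group_add \<Rightarrow> 'l \<Rightarrow> 'l) \<Rightarrow> ('l \<Rightarrow> 'l)
    \<Rightarrow> ('l \<Rightarrow> 'l) \<Rightarrow> ('l \<Rightarrow> 'v \<Rightarrow> 'v) \<Rightarrow> ('v \<Rightarrow> 'v) \<Rightarrow> ('v \<Rightarrow> 'v) \<Rightarrow> nat
    \<Rightarrow> ('l, 'v) cochain_RLieDer \<Rightarrow> ('l, 'v) cochain_RLieDer" where
  "D_RLieDer scaleV br R d rho RV dV n = (\<lambda>(p, q).
    (if n = 1 then (D_R scaleV br R rho RV 1 p, - Delta_R d dV 1 p)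
     else (D_R scaleV br R rho RV n p,
           D_R scaleV br R rho RV (n - 1) q
             + scale_R scaleV ((-1) ^ n) (Delta_R d dV n p))))"

text \<open>
  A cochain complex of vector spaces in degrees \<open>n \<ge> 1\<close>: the spaces are subspaces of one ambient
  vector space, and the differential in degree \<open>n\<close> matters only on \<open>C n\<close>.
\<close>

locale cochain_complex = vector_space scale
  for scale :: "'k::field \<Rightarrow> 'a::ab_group_add \<Rightarrow> 'a" +
  fixes C :: "nat \<Rightarrow> 'a set"
    and D :: "nat \<Rightarrow> 'a \<Rightarrow> 'a"
  assumes subspace_C: "n \<ge> 1 \<Longrightarrow> subspace (C n)"
    and D_into: "n \<ge> 1 \<Longrightarrow> c \<in> C n \<Longrightarrow> D n c \<in> C (n + 1)"
    and D_add: "n \<ge> 1 \<Longrightarrow> c \<in> C n \<Longrightarrow> c' \<in> C n \<Longrightarrow> D n (c + c') = D n c + D n c'"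
    and D_scale: "n \<ge> 1 \<Longrightarrow> c \<in> C n \<Longrightarrow> D n (scale a c) = scale a (D n c)"
    and D_D: "n \<ge> 1 \<Longrightarrow> c \<in> C n \<Longrightarrow> D (n + 1) (D n c) = 0"

end

theory Submission
  imports Defs
begin

text \<open>
  Since \<open>D_R\<close> and \<open>Delta_R\<close> commute on pairs of cochains, the signs \<open>(-1) ^ n\<close> and
  \<open>(-1) ^ (n + 1)\<close> of two consecutive total differentials cancel, and everything comes down to
  six identities on cochains: \<open>delta_CE\<close> and \<open>delta_R\<close> square to zero, \<open>phi\<close> is a cochain map
  from \<open>delta_CE\<close> to \<open>delta_R\<close>, and \<open>Delta\<close> commutes with all three.

  Index bookkeeping is confined to a few comparison lemmas. Write \<open>\<iota>\<^sub>x f\<close> for the contraction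
  \<open>\<lambda>ys. f (x # ys)\<close>. Endomorphisms \<open>E\<close> of \<open>V\<close> and \<open>D\<close> of \<open>L\<close> act on all alternating maps at once by
  \<open>T f (x\<^sub>1, \<dots>) = E (f (x\<^sub>1, \<dots>)) - (\<Sum>i. f (\<dots>, D x\<^sub>i, \<dots>))\<close>. The choice \<open>(rho x, br x)\<close> gives the Lie
  derivative \<open>L\<^sub>x\<close>, the choice \<open>(dV, d)\<close> gives \<open>- Delta\<close>. Every operator of the complex is determined
  by how it passes through a contraction:
  \<^item> \<open>\<iota>\<^sub>x (T f) = T (\<iota>\<^sub>x f) - \<iota>\<^bsub>D x\<^esub> f\<close>;
  \<^item> \<open>\<iota>\<^sub>x (\<delta> f) = L\<^sub>x f - \<delta> (\<iota>\<^sub>x f)\<close>, Cartan's formula, for the Chevalley-Eilenberg differential \<open>\<delta>\<close>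
    with its usual sign, so that \<open>delta_CE\<close> is \<open>(-1) ^ (n + 1)\<close> times \<open>\<delta>\<close> in degree \<open>n\<close>;
  \<^item> \<open>\<iota>\<^sub>x (phi f) = phi (\<iota>\<^bsub>R x\<^esub> f) - RV \<circ> (\<iota>\<^bsub>x - R x\<^esub> f) \<circ> R\<close>, where \<open>R\<close> is applied to each argument.

  Reading these as recursions on the list of arguments turns each identity into a short induction.
  A pair \<open>(E, D)\<close> acting by derivations of bracket and action commutes with \<open>\<delta>\<close>
  (\<open>ce_induced_action\<close>). Inner derivations are such pairs, whence \<open>\<delta> \<circ> \<delta> = 0\<close> (\<open>ce_ce\<close>), and so is
  \<open>(dV, d)\<close>. The twisted bracket and action again form a representation of a Lie algebra, which
  settles \<open>delta_R\<close>. For \<open>phi\<close> the inputs are \<open>R [x, y]\<^sub>R = [R x, R y]\<close> and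
  \<open>rho_R x (RV u) = RV (rho (R x) u)\<close>: they make \<open>f \<mapsto> RV \<circ> f \<circ> R\<close> a cochain map (\<open>ceR_pullback\<close>), and
  one commutation rule for induced actions (\<open>induced_action_rmap\<close>) then gives both
  \<open>\<delta>\<^sub>R \<circ> phi = phi \<circ> \<delta>\<close> and the commutation of \<open>Delta\<close> with \<open>phi\<close>.
\<close>

section \<open>Alternating multilinear maps on lists\<close>

lemma
  assumes "Vector_Spaces.linear s t f"
  shows lin_add: "f (x + y) = f x + f y"
    and lin_diff: "f (x - y) = f x - f y"
    and lin_scale: "f (s c x) = t c (f x)"
    and lin_neg: "f (- x) = - f x"
    and lin_zero: "f 0 = 0"
proof -
  interpret Vector_Spaces.linear s t f by fact
  show "f (x + y) = f x + f y" "f (x - y) = f x - f y" "f (s c x) = t c (f x)" "f (- x) = - f x" "f 0 = 0"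
    by (rule add diff scale neg zero)+
qed

lemma omit_0 [simp]: "omit 0 (x # xs) = xs"
  and omit_Suc [simp]: "omit (Suc i) (x # xs) = x # omit i xs"
  by (simp_all add: omit_def)

locale cochain_spaces = vector_space_pair s1 s2
  for s1 :: "'k::field \<Rightarrow> 'l::ab_group_add \<Rightarrow> 'l" and s2 :: "'k \<Rightarrow> 'v::ab_group_add \<Rightarrow> 'v"
begin

lemma linear_mapI:
  "(\<And>x y. f (x + y) = f x + f y) \<Longrightarrow> (\<And>c x. f (s1 c x) = s2 c (f x)) \<Longrightarrow>
      Vector_Spaces.linear s1 s2 f"
  by (simp add: Vector_Spaces.linear_iff vs1.vector_space_axioms vs2.vector_space_axioms)

text \<open>
  The condition concerns all lengths at once, so that operators need not mention a degree, and it
  compares neighbours only, so that it can be checked by induction on the prefix \<open>ps\<close>. That any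
  repeated argument then gives 0 is \<open>alternating_eq_nth\<close>.
\<close>

definition alternating :: "('l list \<Rightarrow> 'v) \<Rightarrow> bool" where
  "alternating f \<longleftrightarrow>
    (\<forall>ps xs. Vector_Spaces.linear s1 s2 (\<lambda>x. f (ps @ x # xs))) \<and> (\<forall>ps x xs. f (ps @ x # x # xs) = 0)"

lemma alternating_linear: "alternating f \<Longrightarrow> Vector_Spaces.linear s1 s2 (\<lambda>x. f (ps @ x # xs))"
  and alternating_repeat: "alternating f \<Longrightarrow> f (ps @ x # x # xs) = 0"
  by (simp_all add: alternating_def)

lemma alternating_hd_add: "alternating f \<Longrightarrow> f ((x + y) # xs) = f (x # xs) + f (y # xs)"
  and alternating_hd_diff: "alternating f \<Longrightarrow> f ((x - y) # xs) = f (x # xs) - f (y # xs)"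
  and alternating_hd_scale: "alternating f \<Longrightarrow> f (s1 c x # xs) = s2 c (f (x # xs))"
  and alternating_hd_zero: "alternating f \<Longrightarrow> f (0 # xs) = 0"
  and alternating_hd_repeat: "alternating f \<Longrightarrow> f (x # x # xs) = 0"
  using lin_add[OF alternating_linear[of f "[]" xs]] lin_diff[OF alternating_linear[of f "[]" xs]]
    lin_scale[OF alternating_linear[of f "[]" xs]] lin_zero[OF alternating_linear[of f "[]" xs]]
    alternating_repeat[of f "[]"]
  by simp_all

lemma alternating_contract: "alternating f \<Longrightarrow> alternating (\<lambda>xs. f (x # xs))"
  using alternating_linear[of f "x # _"] alternating_repeat[of f "x # _"] by (simp add: alternating_def)

lemma alternating_zero: "alternating (\<lambda>xs. 0)"
  by (simp add: alternating_def linear_mapI)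

lemma alternating_add: "alternating f \<Longrightarrow> alternating g \<Longrightarrow> alternating (\<lambda>xs. f xs + g xs)"
  by (simp add: alternating_def vector_space_pair.linear_compose_add[OF vector_space_pair_axioms])

lemma alternating_diff: "alternating f \<Longrightarrow> alternating g \<Longrightarrow> alternating (\<lambda>xs. f xs - g xs)"
  by (simp add: alternating_def vector_space_pair.linear_compose_sub[OF vector_space_pair_axioms])

lemma alternating_scale: "alternating f \<Longrightarrow> alternating (\<lambda>xs. s2 c (f xs))"
  by (simp add: alternating_def vector_space_pair.linear_compose_scale_right[OF vector_space_pair_axioms])

lemma alternating_swap:
  assumes "alternating f"
  shows "f (ps @ x # y # xs) = - f (ps @ y # x # xs)"
proof -
  have add1: "f (ps @ (a + b) # zs) = f (ps @ a # zs) + f (ps @ b # zs)" for a b zs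
    using lin_add[OF alternating_linear[OF assms, of ps zs], of a b] by simp
  have add2: "f (ps @ z # (a + b) # xs) = f (ps @ z # a # xs) + f (ps @ z # b # xs)" for z a b
    using lin_add[OF alternating_linear[OF assms, of "ps @ [z]" xs], of a b] by simp
  have "f (ps @ x # (x + y) # xs) + f (ps @ y # (x + y) # xs) = 0"
    using add1[of x y "(x + y) # xs"] alternating_repeat[OF assms, of ps "x + y" xs] by simp
  then have "f (ps @ x # y # xs) + f (ps @ y # x # xs) = 0"
    using add2[of x x y] add2[of y x y] alternating_repeat[OF assms, of ps x xs]
      alternating_repeat[OF assms, of ps y xs] by simp
  then show ?thesis unfolding eq_neg_iff_add_eq_0 .
qed

lemma alternating_hd_swap: "alternating f \<Longrightarrow> f (x # y # xs) = - f (y # x # xs)"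
  using alternating_swap[of f "[]" x y xs] by simp

text \<open>
  The operators below are recursive in the list of arguments and therefore cannot be checked one slot
  at a time. It suffices to look at the first slots, provided the contraction of \<open>F f\<close> is, up to
  an alternating summand, a multiple of \<open>F\<close> applied to another alternating map.
\<close>

lemma alternating_operatorI:
  assumes lin: "\<And>f xs. alternating f \<Longrightarrow> Vector_Spaces.linear s1 s2 (\<lambda>x. F f (x # xs))"
    and rep: "\<And>f x xs. alternating f \<Longrightarrow> F f (x # x # xs) = 0"
    and rec: "\<And>f p. alternating f \<Longrightarrow>
        \<exists>c g h. alternating g \<and> alternating h \<and> (\<forall>xs. F f (p # xs) = s2 c (F g xs) + h xs)"
    and f: "alternating f"
  shows "alternating (F f)"
proof -
  have "Vector_Spaces.linear s1 s2 (\<lambda>x. F f (ps @ x # xs)) \<and> F f (ps @ y # y # xs) = 0"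
    for ps xs y
    using f
  proof (induction ps arbitrary: f)
    case Nil
    then show ?case by (simp add: lin rep)
  next
    case (Cons p ps)
    obtain c g h where gh: "alternating g" "alternating h" "\<And>xs. F f (p # xs) = s2 c (F g xs) + h xs"
      using rec[OF Cons.prems] by meson
    show ?case
      using Cons.IH[OF gh(1)]
      by (simp add: gh(3) alternating_linear[OF gh(2)] alternating_repeat[OF gh(2)]
          vector_space_pair.linear_compose_add[OF vector_space_pair_axioms]
          vector_space_pair.linear_compose_scale_right[OF vector_space_pair_axioms])
  qed
  then show ?thesis by (simp add: alternating_def)
qed

text \<open>
  Carrying the first argument past \<open>i\<close> others costs one sign each. This is what relates the bracket
  terms of the differential to substitutions into a single slot.
\<close>

lemma alternating_move:
  assumes "alternating f" and "i < length xs"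
  shows "f (y # omit i xs) = s2 ((-1) ^ i) (f (xs[i := y]))"
  using assms
proof (induction i arbitrary: f xs)
  case 0
  then show ?case by (cases xs) (simp_all add: omit_def)
next
  case (Suc i)
  then obtain z zs where xs: "xs = z # zs" and i: "i < length zs" by (cases xs) auto
  have "f (y # omit (Suc i) xs) = - f (z # y # omit i zs)"
    using alternating_hd_swap[OF Suc.prems(1), of y z] by (simp add: xs omit_def)
  also have "f (z # y # omit i zs) = s2 ((-1) ^ i) (f (z # zs[i := y]))"
    by (rule Suc.IH[OF alternating_contract[OF Suc.prems(1)] i])
  finally show ?case by (simp add: xs vs2.scale_minus_left)
qed

lemma alternating_eq_nth:
  assumes f: "alternating f" and "i < j" and "j < length xs" and "xs ! i = xs ! j"
  shows "f xs = 0"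
proof -
  define y where "y = xs ! j"
  define ps where "ps = take i xs"
  define zs where "zs = drop (Suc i) xs"
  have xs: "xs = ps @ y # zs"
    using assms id_take_nth_drop[of i xs] by (simp add: ps_def zs_def y_def)
  define k where "k = j - Suc i"
  have k: "k < length zs" "zs ! k = y"
    using assms by (auto simp: k_def zs_def y_def)
  have g: "alternating (\<lambda>us. f (ps @ us))"
    using alternating_linear[OF f, of "ps @ _"] alternating_repeat[OF f, of "ps @ _"]
    by (simp add: alternating_def)
  have "f (ps @ y # y # omit k zs) = s2 ((-1) ^ k) (f (ps @ y # zs[k := y]))"
    by (rule alternating_move[OF alternating_contract[OF g] k(1)])
  moreover have "zs[k := y] = zs" using k by auto
  ultimately have "s2 ((-1) ^ k) (f xs) = 0"
    by (simp add: alternating_repeat[OF f] xs)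
  then show ?thesis by simp
qed

lemma cochains_iff:
  "f \<in> cochains s1 s2 n \<longleftrightarrow> alternating f \<and> (\<forall>xs. length xs \<noteq> n \<longrightarrow> f xs = 0)"
proof
  assume f: "f \<in> cochains s1 s2 n"
  then have supp: "\<And>xs. length xs \<noteq> n \<Longrightarrow> f xs = 0"
    and lin: "\<And>xs i. length xs = n \<Longrightarrow> i < n \<Longrightarrow> Vector_Spaces.linear s1 s2 (\<lambda>x. f (xs[i := x]))"
    and alt: "\<And>xs i j. length xs = n \<Longrightarrow> i < j \<Longrightarrow> j < n \<Longrightarrow> xs ! i = xs ! j \<Longrightarrow> f xs = 0"
    unfolding cochains_def by blast+
  have "Vector_Spaces.linear s1 s2 (\<lambda>x. f (ps @ x # xs))" for ps xs
  proof (cases "Suc (length ps + length xs) = n")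
    case True
    then show ?thesis using lin[of "ps @ 0 # xs" "length ps"] by simp
  next
    case False
    then show ?thesis by (simp add: supp linear_mapI)
  qed
  moreover have "f (ps @ x # x # xs) = 0" for ps x xs
    using alt[of "ps @ x # x # xs" "length ps" "Suc (length ps)"] supp[of "ps @ x # x # xs"]
    by (cases "Suc (Suc (length ps + length xs)) = n") (auto simp: nth_append)
  ultimately show "alternating f \<and> (\<forall>xs. length xs \<noteq> n \<longrightarrow> f xs = 0)"
    using supp by (simp add: alternating_def)
next
  assume f: "alternating f \<and> (\<forall>xs. length xs \<noteq> n \<longrightarrow> f xs = 0)"
  then show "f \<in> cochains s1 s2 n"
    unfolding cochains_def
    by (auto simp: upd_conv_take_nth_drop alternating_linear intro: alternating_eq_nth)
qed

end

section \<open>Actions induced by a pair of endomorphisms\<close>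

fun induced_action ::
  "('v::ab_group_add \<Rightarrow> 'v) \<Rightarrow> ('l \<Rightarrow> 'l) \<Rightarrow> ('l list \<Rightarrow> 'v) \<Rightarrow> 'l list \<Rightarrow> 'v" where
  "induced_action E D f [] = E (f [])"
| "induced_action E D f (x # xs) = induced_action E D (\<lambda>ys. f (x # ys)) xs - f (D x # xs)"

lemma induced_action_explicit:
  "induced_action E D f xs = E (f xs) - (\<Sum>i<length xs. f (xs[i := D (xs ! i)]))"
  by (induction xs arbitrary: f) (simp_all add: sum.lessThan_Suc_shift del: sum.lessThan_Suc)

context cochain_spaces
begin

abbreviation linearV :: "('v \<Rightarrow> 'v) \<Rightarrow> bool" where
  "linearV \<equiv> Vector_Spaces.linear s2 s2"

lemma
  assumes E: "linearV E"
  shows induced_action_add: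
      "induced_action E D (\<lambda>ys. f ys + g ys) xs = induced_action E D f xs + induced_action E D g xs"
    and induced_action_diff:
      "induced_action E D (\<lambda>ys. f ys - g ys) xs = induced_action E D f xs - induced_action E D g xs"
    and induced_action_scale:
      "induced_action E D (\<lambda>ys. s2 c (f ys)) xs = s2 c (induced_action E D f xs)"
    and induced_action_zero: "induced_action E D (\<lambda>ys. 0) xs = 0"
  by (simp_all add: induced_action_explicit lin_add[OF E] lin_diff[OF E] lin_scale[OF E] lin_zero[OF E]
      sum.distrib sum_subtractf vs2.scale_right_diff_distrib vs2.scale_sum_right)

lemma alternating_induced_action:
  assumes E: "linearV E" and D: "Vector_Spaces.linear s1 s1 D" and f: "alternating f"
  shows "alternating (induced_action E D f)"
proof (rule alternating_operatorI[OF _ _ _ f])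
  note alternating_hd = alternating_hd_add alternating_hd_scale
  fix f :: "'l list \<Rightarrow> 'v" assume f: "alternating f"
  show "Vector_Spaces.linear s1 s2 (\<lambda>x. induced_action E D f (x # xs))" for xs
    by (rule linear_mapI) (simp_all add: alternating_hd[OF f]
        induced_action_add[OF E] induced_action_scale[OF E] lin_add[OF D] lin_scale[OF D]
        vs2.scale_right_diff_distrib)
  show "induced_action E D f (x # x # xs) = 0" for x xs
    using alternating_hd_swap[OF f, of x "D x" xs]
    by (simp add: alternating_hd_repeat[OF f] induced_action_zero[OF E])
  show "\<exists>c g h. alternating g \<and> alternating h \<and>
      (\<forall>xs. induced_action E D f (p # xs) = s2 c (induced_action E D g xs) + h xs)" for p
    using alternating_contract[OF f] alternating_diff[OF alternating_zero alternating_contract[OF f, of "D p"]]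
    by (intro exI[of _ 1] exI[of _ "\<lambda>ys. f (p # ys)"] exI[of _ "\<lambda>ys. 0 - f (D p # ys)"]) simp
qed

text \<open>
  The assignment \<open>(E, D) \<mapsto> T\<close> preserves commutators: contraction turns each side into the same
  expression for \<open>\<iota>\<^sub>x f\<close> and a value of \<open>f\<close>, and these values agree because \<open>f\<close> is additive in its
  first slot, which splits the one at \<open>D (D' x) - D' (D x)\<close>.
\<close>

lemma induced_action_commutator:
  assumes E: "linearV E" and E': "linearV E'" and f: "alternating f"
  shows "induced_action E D (induced_action E' D' f) xs - induced_action E' D' (induced_action E D f) xs
    = induced_action (\<lambda>u. E (E' u) - E' (E u)) (\<lambda>x. D (D' x) - D' (D x)) f xs"
  using f
proof (induction xs arbitrary: f)
  case (Cons x xs)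
  show ?case
    using Cons.IH[OF alternating_contract[OF Cons.prems, of x]]
    by (simp add: induced_action_diff[OF E] induced_action_diff[OF E'] alternating_hd_diff[OF Cons.prems]
        algebra_simps)
qed simp

end

section \<open>The Chevalley-Eilenberg differential\<close>

text \<open>
  Cartan's formula \<open>\<iota>\<^sub>x \<circ> \<delta> = L\<^sub>x - \<delta> \<circ> \<iota>\<^sub>x\<close>, taken as a definition so that the sums over one and two
  omitted arguments occur only in the comparison \<open>ce_explicit\<close>.
\<close>

fun ce_differential ::
  "('l \<Rightarrow> 'l \<Rightarrow> 'l) \<Rightarrow> ('l \<Rightarrow> 'v::ab_group_add \<Rightarrow> 'v) \<Rightarrow> ('l list \<Rightarrow> 'v) \<Rightarrow> 'l list \<Rightarrow> 'v" where
  "ce_differential br rho f [] = 0"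
| "ce_differential br rho f (x # xs) =
    induced_action (rho x) (br x) f xs - ce_differential br rho (\<lambda>ys. f (x # ys)) xs"

sublocale lie_representation \<subseteq> cochain_spaces scaleL scaleV
  by unfold_locales

context lie_representation
begin

abbreviation lie_act :: "'l \<Rightarrow> ('l list \<Rightarrow> 'v) \<Rightarrow> 'l list \<Rightarrow> 'v" where
  "lie_act x \<equiv> induced_action (rho x) (br x)"

abbreviation ce :: "('l list \<Rightarrow> 'v) \<Rightarrow> 'l list \<Rightarrow> 'v" where
  "ce \<equiv> ce_differential br rho"

lemma ce_add: "ce (\<lambda>ys. f ys + g ys) xs = ce f xs + ce g xs"
  by (induction xs arbitrary: f g) (simp_all add: induced_action_add[OF rho_endo])

lemma ce_minus: "ce (\<lambda>ys. f ys - g ys) xs = ce f xs - ce g xs"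
  by (induction xs arbitrary: f g) (simp_all add: induced_action_diff[OF rho_endo])

lemma ce_scale: "ce (\<lambda>ys. scaleV c (f ys)) xs = scaleV c (ce f xs)"
  by (induction xs arbitrary: f) (simp_all add: induced_action_scale[OF rho_endo] V.scale_right_diff_distrib)

lemma ce_zero: "ce (\<lambda>ys. 0) xs = 0"
  by (induction xs) (simp_all add: induced_action_zero[OF rho_endo])

lemma lie_act_add: "alternating f \<Longrightarrow> lie_act (x + y) f xs = lie_act x f xs + lie_act y f xs"
proof (induction xs arbitrary: f)
  case (Cons z zs)
  then show ?case
    using Cons.IH[OF alternating_contract[OF Cons.prems]]
    by (simp add: lin_add[OF br_linear_left] alternating_hd_add)
qed (simp add: lin_add[OF rho_linear])

lemma lie_act_scale: "alternating f \<Longrightarrow> lie_act (scaleL c x) f xs = scaleV c (lie_act x f xs)"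
proof (induction xs arbitrary: f)
  case (Cons z zs)
  then show ?case
    using Cons.IH[OF alternating_contract[OF Cons.prems]]
    by (simp add: lin_scale[OF br_linear_left] alternating_hd_scale V.scale_right_diff_distrib)
qed (simp add: lin_scale[OF rho_linear])

lemma alternating_ce:
  assumes "alternating f"
  shows "alternating (ce f)"
proof (rule alternating_operatorI[OF _ _ _ assms])
  fix f :: "'l list \<Rightarrow> 'v" assume f: "alternating f"
  show "Vector_Spaces.linear scaleL scaleV (\<lambda>x. ce f (x # xs))" for xs
    by (rule linear_mapI) (simp_all add: lie_act_add[OF f] lie_act_scale[OF f] alternating_hd_add[OF f]
        alternating_hd_scale[OF f] ce_add ce_scale V.scale_right_diff_distrib)
  (* By Cartan's formula twice, the value is \<open>(\<iota>\<^sub>x L\<^sub>x - L\<^sub>x \<iota>\<^sub>x) f\<close>, that is \<open>- f ([x, x], \<dots>)\<close>. *)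
  show "ce f (x # x # xs) = 0" for x xs
    by (simp add: br_self alternating_hd_zero[OF f] alternating_hd_repeat[OF f] ce_zero)
  show "\<exists>c g h. alternating g \<and> alternating h \<and> (\<forall>xs. ce f (p # xs) = scaleV c (ce g xs) + h xs)" for p
    using alternating_contract[OF f] alternating_induced_action[OF rho_endo br_linear_right f]
    by (intro exI[of _ "-1"] exI[of _ "\<lambda>ys. f (p # ys)"] exI[of _ "lie_act p f"])
      (simp add: V.scale_minus_left)
qed

text \<open>
  Contracting both sides with \<open>x\<close> leaves \<open>[T, L\<^sub>x] = L\<^bsub>D x\<^esub>\<close>, which is the hypothesis that \<open>(E, D)\<close> acts by
  derivations, and the same claim for \<open>\<iota>\<^sub>x f\<close>.
\<close>

lemma ce_induced_action:
  assumes E: "Vector_Spaces.linear scaleV scaleV E"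
    and D: "\<And>x y. D (br x y) = br (D x) y + br x (D y)"
    and ED: "\<And>x u. E (rho x u) = rho (D x) u + rho x (E u)"
    and f: "alternating f"
  shows "induced_action E D (ce f) xs = ce (induced_action E D f) xs"
  using f
proof (induction xs arbitrary: f)
  case Nil
  then show ?case by (simp add: lin_zero[OF E])
next
  case (Cons x xs)
  note f = Cons.prems
  have "induced_action E D (lie_act x f) xs - lie_act x (induced_action E D f) xs = lie_act (D x) f xs"
    using induced_action_commutator[OF E rho_endo f, of D x "br x" xs] by (simp add: D ED)
  then show ?case
    using Cons.IH[OF alternating_contract[OF f, of x]]
    by (simp add: induced_action_diff[OF E] ce_minus algebra_simps)
qed

lemma br_swap: "br x y = - br y x"
proof -
  have "br (x + y) (x + y) = br x y + br y x"
    unfolding lin_add[OF br_linear_left] unfolding lin_add[OF br_linear_right] by (simp add: br_self)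
  then show ?thesis by (simp add: br_self eq_neg_iff_add_eq_0)
qed

lemma br_derivation: "br x (br y z) = br (br x y) z + br y (br x z)"
  using jacobi[of x y z] br_swap[of z "br x y"] br_swap[of z x] lin_diff[OF br_linear_right, of y 0 "br x z"]
    lin_zero[OF br_linear_right, of y]
  by (simp add: algebra_simps)

text \<open>
  By Cartan's formula \<open>\<iota>\<^sub>x (\<delta> (\<delta> f)) = (L\<^sub>x \<circ> \<delta> - \<delta> \<circ> L\<^sub>x) f + \<delta> (\<delta> (\<iota>\<^sub>x f))\<close>, and \<open>L\<^sub>x\<close> commutes with \<open>\<delta>\<close> because
  inner derivations are derivations.
\<close>

lemma ce_ce:
  assumes "alternating f"
  shows "ce (ce f) xs = 0"
  using assms
proof (induction xs arbitrary: f)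
  case (Cons x xs)
  note f = Cons.prems
  have "lie_act x (ce f) xs = ce (lie_act x f) xs"
    by (rule ce_induced_action[OF rho_endo br_derivation _ f]) (simp add: rho_br)
  then show ?case
    using Cons.IH[OF alternating_contract[OF f, of x]] by (simp add: ce_minus)
qed simp

lemma ce_support:
  assumes "\<And>ys. length ys \<noteq> n \<Longrightarrow> f ys = 0" and "length xs \<noteq> n + 1"
  shows "ce f xs = 0"
  using assms
proof (induction xs arbitrary: f n)
  case (Cons x xs)
  have act: "lie_act x f xs = 0"
    using Cons.prems by (simp add: induced_action_explicit lin_zero[OF rho_endo])
  show ?case
  proof (cases n)
    case 0
    then have "(\<lambda>ys. f (x # ys)) = (\<lambda>ys. 0)" using Cons.prems by auto
    then show ?thesis using act by (simp only: ce_differential.simps ce_zero) simp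
  next
    case (Suc m)
    then show ?thesis using Cons.IH[of m "\<lambda>ys. f (x # ys)"] Cons.prems act by simp
  qed
qed simp

text \<open>
  The terms of the classical formula that involve the first argument \<open>x\<close> through the action or through
  a bracket \<open>[x, x\<^sub>j]\<close> add up to \<open>L\<^sub>x f\<close>; the others are those of \<open>\<iota>\<^sub>x f\<close> with opposite sign.
\<close>

lemma ce_explicit:
  assumes "alternating f"
  shows "ce f xs = (\<Sum>i<length xs. scaleV ((-1) ^ i) (rho (xs ! i) (f (omit i xs))))
    + (\<Sum>j<length xs. \<Sum>i<j. scaleV ((-1) ^ (i + j)) (f (br (xs ! i) (xs ! j) # omit i (omit j xs))))"
  using assms
proof (induction xs arbitrary: f)
  case (Cons x xs)
  note f = Cons.prems
  have move: "(\<Sum>j<length xs. scaleV ((-1) ^ j) (f (br x (xs ! j) # omit j xs)))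
      = (\<Sum>j<length xs. f (xs[j := br x (xs ! j)]))"
    by (simp add: alternating_move[OF f] flip: power_add)
  have swap: "f (br y z # x # zs) = - f (x # br y z # zs)" for y z zs
    by (rule alternating_hd_swap[OF f])
  show ?case
    using Cons.IH[OF alternating_contract[OF f, of x]] move
    by (simp add: sum.lessThan_Suc_shift induced_action_explicit swap V.scale_minus_left sum_negf
        sum.distrib sum_subtractf algebra_simps del: sum.lessThan_Suc)
qed simp

lemma delta_CE_eq:
  assumes "f \<in> cochains scaleL scaleV n"
  shows "delta_CE scaleV br rho n f = (\<lambda>xs. scaleV ((-1) ^ (n + 1)) (ce f xs))"
proof
  fix xs
  have f: "alternating f" and supp: "\<And>ys. length ys \<noteq> n \<Longrightarrow> f ys = 0"
    using assms by (auto simp: cochains_iff)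
  show "delta_CE scaleV br rho n f xs = scaleV ((-1) ^ (n + 1)) (ce f xs)"
  proof (cases "length xs = n + 1")
    case True
    have "scaleV ((-1) ^ (Suc i + n)) u = scaleV ((-1) ^ (n + 1)) (scaleV ((-1) ^ i) u)"
      and "scaleV ((-1) ^ (Suc i + Suc j + n + 1)) u = scaleV ((-1) ^ (n + 1)) (scaleV ((-1) ^ (i + j)) u)"
      for i j u
      by (simp_all add: algebra_simps power_add)
    then show ?thesis
      unfolding delta_CE_def ce_explicit[OF f] True
      by (simp only: True V.scale_right_distrib V.scale_sum_right if_True refl)
  next
    case False
    then show ?thesis using ce_support[OF supp] by (simp add: delta_CE_def)
  qed
qed

lemma ce_cochains: "f \<in> cochains scaleL scaleV n \<Longrightarrow> ce f \<in> cochains scaleL scaleV (n + 1)"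
  using alternating_ce ce_support by (metis cochains_iff)

abbreviation C :: "nat \<Rightarrow> ('l list \<Rightarrow> 'v) set" where
  "C \<equiv> cochains scaleL scaleV"

lemma C_zero: "0 \<in> C n"
  and C_add: "f \<in> C n \<Longrightarrow> g \<in> C n \<Longrightarrow> f + g \<in> C n"
  and C_scale: "f \<in> C n \<Longrightarrow> (\<lambda>xs. scaleV c (f xs)) \<in> C n"
  and C_uminus: "f \<in> C n \<Longrightarrow> - f \<in> C n"
  and C_diff: "f \<in> C n \<Longrightarrow> g \<in> C n \<Longrightarrow> f - g \<in> C n"
  using alternating_diff[OF alternating_zero]
  by (simp_all add: cochains_iff zero_fun_def plus_fun_def fun_Compl_def fun_diff_def alternating_zero
      alternating_add alternating_scale alternating_diff)

abbreviation delCE :: "nat \<Rightarrow> ('l list \<Rightarrow> 'v) \<Rightarrow> 'l list \<Rightarrow> 'v" where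
  "delCE \<equiv> delta_CE scaleV br rho"

lemma delCE_in: "f \<in> C n \<Longrightarrow> delCE n f \<in> C (n + 1)"
  by (simp only: delta_CE_eq C_scale ce_cochains)

lemma delCE_delCE:
  assumes f: "f \<in> C n"
  shows "delCE (n + 1) (delCE n f) = 0"
proof -
  obtain c where c: "delCE n f = (\<lambda>xs. scaleV c (ce f xs))" using delta_CE_eq[OF f] by blast
  obtain c' where c': "delCE (n + 1) (delCE n f) = (\<lambda>xs. scaleV c' (ce (delCE n f) xs))"
    using delta_CE_eq[OF delCE_in[OF f]] by blast
  show ?thesis using f unfolding c' unfolding c by (auto simp: ce_scale ce_ce cochains_iff fun_eq_iff)
qed

lemma delta_CE_add: "delta_CE scaleV br rho n (f + g) = delta_CE scaleV br rho n f + delta_CE scaleV br rho n g"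
  by (rule ext) (simp add: delta_CE_def lin_add[OF rho_endo] V.scale_right_distrib sum.distrib
      del: power_Suc sum.lessThan_Suc)

lemma delta_CE_scale:
  "delta_CE scaleV br rho n (\<lambda>xs. scaleV c (f xs)) = (\<lambda>xs. scaleV c (delta_CE scaleV br rho n f xs))"
  by (rule ext) (simp add: delta_CE_def lin_scale[OF rho_endo] V.scale_right_distrib V.scale_sum_right
      mult.commute del: power_Suc sum.lessThan_Suc)

end

section \<open>The Lie algebra and the representation twisted by the Reynolds operators\<close>

context reynolds_lieder_representation
begin

lemmas bracket_simps =
  lin_add[OF br_linear_right] lin_add[OF br_linear_left] lin_diff[OF br_linear_right]
  lin_diff[OF br_linear_left] lin_scale[OF br_linear_right] lin_scale[OF br_linear_left]
  lin_add[OF R_linear] lin_diff[OF R_linear] lin_scale[OF R_linear]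

lemmas action_simps =
  lin_add[OF rho_endo] lin_add[OF rho_linear] lin_diff[OF rho_endo] lin_diff[OF rho_linear]
  lin_scale[OF rho_endo] lin_scale[OF rho_linear]
  lin_add[OF RV_linear] lin_diff[OF RV_linear] lin_scale[OF RV_linear]

text \<open>
  The two identities below are the Reynolds conditions, rewritten: \<open>R\<close> is a homomorphism from the twisted
  bracket to the original one, and \<open>RV\<close> intertwines \<open>rho \<circ> R\<close> with the twisted action.
\<close>

lemma R_bracket_R: "R (bracket_R br R x y) = br (R x) (R y)"
  unfolding bracket_R_def by (subst reynolds) (simp only: add.commute)

lemma rho_R_RV: "rho_R rho R RV x (RV u) = RV (rho (R x) u)"
proof -
  have "rho_R rho R RV x (RV u) = rho (R x) (RV u) + RV (rho (R x) (RV u) - rho x (RV u))"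
    by (simp only: rho_R_def)
  also have "\<dots> = RV (rho (R x) u)"
    by (subst RV_reynolds) (simp add: action_simps)
  finally show ?thesis .
qed

end

sublocale reynolds_lieder_representation \<subseteq>
  twisted: lie_representation scaleL "bracket_R br R" scaleV "rho_R rho R RV"
proof (intro lie_representation.intro lie_algebra.intro lie_algebra_axioms.intro
    lie_representation_axioms.intro)
  show "vector_space scaleL" "vector_space scaleV"
    by (fact vector_space_axioms V.vector_space_axioms)+
  show "Vector_Spaces.linear scaleL scaleL (bracket_R br R x)" for x
    by (simp add: Vector_Spaces.linear_iff vector_space_axioms bracket_R_def bracket_simps
        scale_right_distrib scale_right_diff_distrib)
  show "Vector_Spaces.linear scaleL scaleL (\<lambda>x. bracket_R br R x y)" for y
    by (simp add: Vector_Spaces.linear_iff vector_space_axioms bracket_R_def bracket_simps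
        scale_right_distrib scale_right_diff_distrib)
  show "bracket_R br R x x = 0" for x
    using br_swap[of x "R x"] by (simp add: bracket_R_def br_self)
  show "bracket_R br R x (bracket_R br R y z) + bracket_R br R y (bracket_R br R z x)
      + bracket_R br R z (bracket_R br R x y) = 0" for x y z
  proof -
    (* Summed cyclically, the terms with exactly two images under \<open>R\<close> group into three Jacobi
       identities, and each half of the rest is the Jacobi identity for \<open>R x\<close>, \<open>R y\<close>, \<open>R z\<close>. *)
    have expand: "bracket_R br R x (bracket_R br R y z) = br x (br (R y) (R z)) + br (R x) (br y (R z))
        + br (R x) (br (R y) z) - br (R x) (br (R y) (R z)) - br (R x) (br (R y) (R z))" for x y z
    proof -
      have "bracket_R br R x (bracket_R br R y z) =
          br x (br (R y) (R z)) + br (R x) (bracket_R br R y z) - br (R x) (br (R y) (R z))"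
        by (simp only: bracket_R_def[of br R x] R_bracket_R)
      then show ?thesis by (simp add: bracket_R_def bracket_simps)
    qed
    have cancel: "(a1 + b1 + c1 - e1 - e1) + (a2 + b2 + c2 - e2 - e2) + (a3 + b3 + c3 - e3 - e3) = 0"
      if "a1 + c2 + b3 = 0" "a2 + c3 + b1 = 0" "a3 + c1 + b2 = 0" "e1 + e2 + e3 = 0"
      for a1 a2 a3 b1 b2 b3 c1 c2 c3 e1 e2 e3 :: 'l
    proof -
      have "(a1 + b1 + c1 - e1 - e1) + (a2 + b2 + c2 - e2 - e2) + (a3 + b3 + c3 - e3 - e3)
        = (a1 + c2 + b3) + (a2 + c3 + b1) + (a3 + c1 + b2) - (e1 + e2 + e3) - (e1 + e2 + e3)"
        by (simp add: algebra_simps)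
      then show ?thesis by (simp add: that)
    qed
    show ?thesis
      unfolding expand
      by (rule cancel; (rule jacobi)?)
  qed
  show "Vector_Spaces.linear scaleV scaleV (rho_R rho R RV x)" for x
    by (simp add: Vector_Spaces.linear_iff V.vector_space_axioms rho_R_def action_simps
        V.scale_right_distrib V.scale_right_diff_distrib)
  show "Vector_Spaces.linear scaleL scaleV (\<lambda>x. rho_R rho R RV x u)" for u
    by (simp add: Vector_Spaces.linear_iff vector_space_axioms V.vector_space_axioms rho_R_def
        bracket_simps action_simps V.scale_right_distrib V.scale_right_diff_distrib)
  show "rho_R rho R RV (bracket_R br R x y) u
      = rho_R rho R RV x (rho_R rho R RV y u) - rho_R rho R RV y (rho_R rho R RV x u)" for x y u
  proof -
    have "rho_R rho R RV x (rho_R rho R RV y u) = rho (R x) (rho (R y) u)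
        + RV (rho (R x) (rho (R y) u)) - RV (rho x (rho (R y) u))
        + RV (rho (R x) (rho (R y) u)) - RV (rho (R x) (rho y u))" for x y
    proof -
      have "rho_R rho R RV x (rho_R rho R RV y u)
          = rho_R rho R RV x (rho (R y) u) + rho_R rho R RV x (RV (rho (R y) u - rho y u))"
        by (simp add: rho_R_def action_simps)
      then show ?thesis unfolding rho_R_RV by (simp add: rho_R_def action_simps)
    qed
    then show ?thesis
      by (simp add: rho_R_def R_bracket_R action_simps)
        (simp add: bracket_R_def rho_br action_simps)
  qed
qed

section \<open>The cochain map between the two differentials\<close>

text \<open>
  The terms of \<open>phi\<close> regroup as \<open>f \<circ> R - RV \<circ> f \<circ> R - RV \<circ> \<Psi> f\<close>, where \<open>\<Psi> f\<close> is the sum over \<open>i\<close> of the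
  values \<open>f (R x\<^sub>1, \<dots>, x\<^sub>i - R x\<^sub>i, \<dots>, R x\<^sub>n)\<close>; this form has no degree in it. In degree 0 it reads
  \<open>f - RV f\<close>, which is the formula for \<open>phi\<close> with the integer \<open>-1\<close> in place of \<open>n - 1\<close>, and with this
  value the cochain map identity starts in degree 0.
\<close>

fun reynolds_map ::
  "('l::ab_group_add \<Rightarrow> 'l) \<Rightarrow> ('v::ab_group_add \<Rightarrow> 'v) \<Rightarrow> ('l list \<Rightarrow> 'v) \<Rightarrow> 'l list \<Rightarrow> 'v" where
  "reynolds_map R RV f [] = f [] - RV (f [])"
| "reynolds_map R RV f (x # xs) =
    reynolds_map R RV (\<lambda>ys. f (R x # ys)) xs - RV (f ((x - R x) # map R xs))"

context reynolds_lieder_representation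
begin

abbreviation ceR :: "('l list \<Rightarrow> 'v) \<Rightarrow> 'l list \<Rightarrow> 'v" where
  "ceR \<equiv> ce_differential (bracket_R br R) (rho_R rho R RV)"

abbreviation rmap :: "('l list \<Rightarrow> 'v) \<Rightarrow> 'l list \<Rightarrow> 'v" where
  "rmap \<equiv> reynolds_map R RV"

lemma rmap_add: "rmap (\<lambda>ys. f ys + g ys) xs = rmap f xs + rmap g xs"
  by (induction xs arbitrary: f g) (simp_all add: action_simps)

lemma rmap_diff: "rmap (\<lambda>ys. f ys - g ys) xs = rmap f xs - rmap g xs"
  by (induction xs arbitrary: f g) (simp_all add: action_simps)

lemma rmap_scale: "rmap (\<lambda>ys. scaleV c (f ys)) xs = scaleV c (rmap f xs)"
  by (induction xs arbitrary: f) (simp_all add: action_simps V.scale_right_diff_distrib)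

lemma rmap_zero: "rmap (\<lambda>ys. 0) xs = 0"
  by (induction xs) (simp_all add: lin_zero[OF RV_linear])

lemma induced_action_pullback:
  assumes "\<And>x. R (D' x) = D (R x)" and "\<And>u. E' (RV u) = RV (E u)"
  shows "induced_action E' D' (\<lambda>ys. RV (f (map R ys))) xs = RV (induced_action E D f (map R xs))"
  by (induction xs arbitrary: f) (simp_all add: assms action_simps)

text \<open>
  The pair \<open>(E', D')\<close> corresponds to \<open>(E, D)\<close> under \<open>RV\<close> and \<open>R\<close>, while \<open>(E'', D'')\<close> measures by how much the
  complementary maps \<open>u \<mapsto> u - RV u\<close> and \<open>x \<mapsto> x - R x\<close> fail to respect this correspondence. The
  defect is zero for \<open>(dV, d)\<close>; for the Lie derivative along \<open>x\<close> it is the action of \<open>x - R x\<close>.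
\<close>

lemma induced_action_rmap:
  assumes E': "Vector_Spaces.linear scaleV scaleV E'"
    and RD: "\<And>x. R (D' x) = D (R x)"
    and RE: "\<And>u. E' (RV u) = RV (E u)"
    and SD: "\<And>x. D' x - R (D' x) = D (x - R x) + D'' (R x)"
    and SE: "\<And>u. E' u - E' (RV u) = E u - RV (E u) - RV (E'' u)"
    and f: "alternating f"
  shows "induced_action E' D' (rmap f) xs
    = rmap (induced_action E D f) xs - RV (induced_action E'' D'' f (map R xs))"
  using f
proof (induction xs arbitrary: f)
  case Nil
  then show ?case using SE by (simp add: lin_diff[OF E'])
next
  case (Cons y ys)
  note f = Cons.prems
  have pullback: "induced_action E' D' (\<lambda>zs. RV (f ((y - R y) # map R zs))) ys
      = RV (induced_action E D (\<lambda>zs. f ((y - R y) # zs)) (map R ys))"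
    by (rule induced_action_pullback[where E = E and D = D]) (fact RD RE)+
  have "f ((D' y - D (R y)) # zs) = f (D (y - R y) # zs) + f (D'' (R y) # zs)" for zs
    using SD[of y] by (simp add: RD alternating_hd_add[OF f])
  then show ?case
    using Cons.IH[OF alternating_contract[OF f, of "R y"]]
    by (simp add: induced_action_diff[OF E'] pullback rmap_diff RD action_simps)
qed

lemma alternating_rmap:
  assumes "alternating f"
  shows "alternating (rmap f)"
proof (rule alternating_operatorI[OF _ _ _ assms])
  fix f :: "'l list \<Rightarrow> 'v" assume f: "alternating f"
  show "Vector_Spaces.linear scaleL scaleV (\<lambda>x. rmap f (x # xs))" for xs
    by (rule linear_mapI) (simp_all add: bracket_simps action_simps alternating_hd_add[OF f]
        alternating_hd_diff[OF f] alternating_hd_scale[OF f] rmap_add rmap_scale V.scale_right_diff_distrib)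
  show "rmap f (x # x # xs) = 0" for x xs
    using alternating_hd_swap[OF f, of x "R x" "map R xs"] alternating_hd_repeat[OF f]
      alternating_hd_diff[OF f] alternating_hd_diff[OF alternating_contract[OF f, of "R x"]]
    by (simp add: rmap_zero action_simps lin_zero[OF RV_linear] lin_neg[OF RV_linear])
  show "\<exists>c g h. alternating g \<and> alternating h \<and> (\<forall>xs. rmap f (p # xs) = scaleV c (rmap g xs) + h xs)" for p
  proof -
    let ?g = "\<lambda>ys. f ((p - R p) # ys)"
    have g: "alternating ?g" by (rule alternating_contract[OF f])
    have "alternating (\<lambda>xs. 0 - RV (?g (map R xs)))"
      unfolding alternating_def
      by (auto intro!: linear_mapI simp: bracket_simps action_simps alternating_repeat[OF g]
          lin_zero[OF RV_linear] V.scale_minus_right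
          lin_add[OF alternating_linear[OF g]] lin_scale[OF alternating_linear[OF g]])
    then show ?thesis using alternating_contract[OF f, of "R p"]
      by (intro exI[of _ 1] exI[of _ "\<lambda>ys. f (R p # ys)"] exI[of _ "\<lambda>xs. 0 - RV (?g (map R xs))"]) simp
  qed
qed

lemma ceR_pullback: "ceR (\<lambda>ys. RV (f (map R ys))) xs = RV (ce f (map R xs))"
proof (induction xs arbitrary: f)
  case Nil
  then show ?case by (simp add: lin_zero[OF RV_linear])
next
  case (Cons x xs)
  then show ?case
    by (simp add: induced_action_pullback[where E="rho (R x)" and D="br (R x)"] R_bracket_R rho_R_RV
        action_simps)
qed

lemma lie_act_rmap:
  assumes "alternating f"
  shows "twisted.lie_act x (rmap f) xs = rmap (lie_act (R x) f) xs - RV (lie_act (x - R x) f (map R xs))"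
proof (rule induced_action_rmap[where E = "rho (R x)" and D = "br (R x)"
      and E'' = "rho (x - R x)" and D'' = "br (x - R x)"])
  show "Vector_Spaces.linear scaleV scaleV (rho_R rho R RV x)" by (rule twisted.rho_endo)
  show "R (bracket_R br R x y) = br (R x) (R y)" for y by (rule R_bracket_R)
  show "rho_R rho R RV x (RV u) = RV (rho (R x) u)" for u by (rule rho_R_RV)
  show "alternating f" by (rule assms)
  show "bracket_R br R x y - R (bracket_R br R x y) = br (R x) (y - R y) + br (x - R x) (R y)" for y
    unfolding R_bracket_R by (simp add: bracket_R_def bracket_simps)
  show "rho_R rho R RV x u - rho_R rho R RV x (RV u)
      = rho (R x) u - RV (rho (R x) u) - RV (rho (x - R x) u)" for u
    unfolding rho_R_RV by (simp add: rho_R_def action_simps)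
qed

text \<open>
  The correction term that \<open>lie_act_rmap\<close> leaves behind is the one that Cartan's formula produces from
  the second summand of \<open>\<iota>\<^sub>x (rmap f)\<close>, since \<open>f \<mapsto> RV \<circ> f \<circ> R\<close> is itself a cochain map.
\<close>

lemma ceR_rmap:
  assumes "alternating f"
  shows "ceR (rmap f) xs = rmap (ce f) xs"
  using assms
proof (induction xs arbitrary: f)
  case Nil
  then show ?case by (simp add: lin_zero[OF RV_linear])
next
  case (Cons x xs)
  note f = Cons.prems
  show ?case
    using Cons.IH[OF alternating_contract[OF f, of "R x"]]
      ceR_pullback[of "\<lambda>ys. f ((x - R x) # ys)" xs]
    by (simp add: twisted.ce_minus rmap_diff lie_act_rmap[OF f] action_simps)
qed

section \<open>Compatibility with the derivations\<close>

abbreviation dact :: "('l list \<Rightarrow> 'v) \<Rightarrow> 'l list \<Rightarrow> 'v" where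
  "dact \<equiv> induced_action dV d"

lemma d_R: "d (R x) = R (d x)" and dV_RV: "dV (RV u) = RV (dV u)"
  using fun_cong[OF R_d_commute, of x] fun_cong[OF RV_dV_commute, of u] by simp_all

lemma dact_ce: "alternating f \<Longrightarrow> dact (ce f) xs = ce (dact f) xs"
  by (rule ce_induced_action[OF dV_linear derivation dV_rho])

lemma dact_ceR:
  assumes "alternating f"
  shows "dact (ceR f) xs = ceR (dact f) xs"
proof (rule twisted.ce_induced_action[OF dV_linear _ _ assms])
  show "d (bracket_R br R x y) = bracket_R br R (d x) y + bracket_R br R x (d y)" for x y
    by (simp add: bracket_R_def lin_add[OF d_linear] lin_diff[OF d_linear] derivation d_R)
  show "dV (rho_R rho R RV x u) = rho_R rho R RV (d x) u + rho_R rho R RV x (dV u)" for x u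
    by (simp add: rho_R_def lin_add[OF dV_linear] lin_diff[OF dV_linear] dV_RV dV_rho d_R action_simps)
qed

lemma dact_rmap:
  assumes f: "alternating f"
  shows "dact (rmap f) xs = rmap (dact f) xs"
proof -
  have "induced_action (\<lambda>u. 0) (\<lambda>x. 0) f ys = 0" for ys
    using f by (simp add: induced_action_explicit upd_conv_take_nth_drop lin_zero[OF alternating_linear[OF f]])
  moreover have "dact (rmap f) xs
      = rmap (dact f) xs - RV (induced_action (\<lambda>u. 0) (\<lambda>x. 0) f (map R xs))"
    by (rule induced_action_rmap)
      (simp_all add: dV_linear f d_R dV_RV lin_diff[OF d_linear] lin_diff[OF dV_linear]
        lin_zero[OF RV_linear])
  ultimately show ?thesis by (simp add: lin_zero[OF RV_linear])
qed

section \<open>The operators of the complex in each degree\<close>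

lemma rmap_explicit:
  assumes "alternating f"
  shows "rmap f xs = f (map R xs) - RV (\<Sum>i<length xs. f ((map R xs)[i := xs ! i]))
    + scaleV (of_nat (length xs)) (RV (f (map R xs))) - RV (f (map R xs))"
  using assms
proof (induction xs arbitrary: f)
  case Nil
  then show ?case by (simp add: lin_zero[OF RV_linear])
next
  case (Cons x xs)
  show ?case
    using Cons.IH[OF alternating_contract[OF Cons.prems, of "R x"]]
    by (simp add: sum.lessThan_Suc_shift alternating_hd_diff[OF Cons.prems] action_simps
        V.scale_left_distrib algebra_simps del: sum.lessThan_Suc)
qed

lemma phi_eq:
  assumes "f \<in> cochains scaleL scaleV n" and "n \<ge> 1"
  shows "phi scaleV R RV n f = rmap f"
proof
  fix xs
  have f: "alternating f" and supp: "\<And>ys. length ys \<noteq> n \<Longrightarrow> f ys = 0"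
    using assms by (auto simp: cochains_iff)
  show "phi scaleV R RV n f xs = rmap f xs"
    using assms(2)
    by (auto simp: phi_def rmap_explicit[OF f] supp lin_zero[OF RV_linear] of_nat_diff
        V.scale_left_diff_distrib)
qed

lemma Delta_eq:
  assumes "f \<in> cochains scaleL scaleV n"
  shows "Delta d dV n f = (\<lambda>xs. - dact f xs)"
  using assms by (auto simp: fun_eq_iff Delta_def induced_action_explicit cochains_iff lin_zero[OF dV_linear])

lemma rmap_cochains:
  assumes "f \<in> cochains scaleL scaleV n"
  shows "rmap f \<in> cochains scaleL scaleV n"
  using assms
  by (auto simp: cochains_iff alternating_rmap rmap_explicit lin_zero[OF RV_linear])

lemma dact_cochains:
  assumes "f \<in> cochains scaleL scaleV n"
  shows "dact f \<in> cochains scaleL scaleV n"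
  using assms
  by (auto simp: cochains_iff alternating_induced_action dV_linear d_linear induced_action_explicit
      lin_zero[OF dV_linear])

abbreviation delR :: "nat \<Rightarrow> ('l list \<Rightarrow> 'v) \<Rightarrow> 'l list \<Rightarrow> 'v" where
  "delR \<equiv> delta_R scaleV br R rho RV"

abbreviation Phi :: "nat \<Rightarrow> ('l list \<Rightarrow> 'v) \<Rightarrow> 'l list \<Rightarrow> 'v" where
  "Phi \<equiv> phi scaleV R RV"

lemma delR_eq: "f \<in> C n \<Longrightarrow> delR n f = (\<lambda>xs. scaleV ((-1) ^ (n + 1)) (ceR f xs))"
  unfolding delta_R_def by (rule twisted.delta_CE_eq)

lemma delR_in: "f \<in> C n \<Longrightarrow> delR n f \<in> C (n + 1)"
  unfolding delta_R_def by (rule twisted.delCE_in)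

lemma Phi_in: "f \<in> C n \<Longrightarrow> n \<ge> 1 \<Longrightarrow> Phi n f \<in> C n"
  by (simp add: phi_eq rmap_cochains)

lemma Delta_in: "f \<in> C n \<Longrightarrow> Delta d dV n f \<in> C n"
  using C_uminus[OF dact_cochains] by (simp add: Delta_eq fun_Compl_def)

lemma delR_delR: "f \<in> C n \<Longrightarrow> delR (n + 1) (delR n f) = 0"
  unfolding delta_R_def by (rule twisted.delCE_delCE)

lemma delR_Phi:
  assumes f: "f \<in> C n" and n: "n \<ge> 1"
  shows "delR n (Phi n f) = Phi (n + 1) (delCE n f)"
proof -
  define c :: 'k where "c = (-1) ^ (n + 1)"
  have "delR n (Phi n f) = (\<lambda>xs. scaleV c (ceR (Phi n f) xs))"
    unfolding c_def by (rule delR_eq[OF Phi_in[OF f n]])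
  moreover have "delCE n f = (\<lambda>xs. scaleV c (ce f xs))"
    unfolding c_def by (rule delta_CE_eq[OF f])
  moreover have "Phi (n + 1) (delCE n f) = rmap (delCE n f)"
    by (rule phi_eq[OF delCE_in[OF f]]) simp
  moreover have "rmap (\<lambda>xs. scaleV c (ce f xs)) = (\<lambda>xs. scaleV c (rmap (ce f) xs))"
    by (rule ext) (rule rmap_scale)
  ultimately show ?thesis
    using f by (simp add: phi_eq[OF f n] ceR_rmap cochains_iff)
qed

lemma Delta_delCE:
  assumes f: "f \<in> C n"
  shows "Delta d dV (n + 1) (delCE n f) = delCE n (Delta d dV n f)"
proof -
  define c :: 'k where "c = (-1) ^ (n + 1)"
  have "delCE n (Delta d dV n f) = (\<lambda>xs. scaleV c (ce (Delta d dV n f) xs))"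
    unfolding c_def by (rule delta_CE_eq[OF Delta_in[OF f]])
  moreover have "delCE n f = (\<lambda>xs. scaleV c (ce f xs))"
    unfolding c_def by (rule delta_CE_eq[OF f])
  moreover have "ce (\<lambda>ys. - dact f ys) xs = - ce (dact f) xs" for xs
    using ce_scale[of "-1" "dact f" xs] by (simp add: V.scale_minus_left)
  ultimately show ?thesis
    using f Delta_eq[OF delCE_in[OF f]]
    by (simp add: Delta_eq[OF f] induced_action_scale[OF dV_linear] dact_ce V.scale_minus_right cochains_iff)
qed

lemma Delta_delR:
  assumes f: "f \<in> C n"
  shows "Delta d dV (n + 1) (delR n f) = delR n (Delta d dV n f)"
proof -
  define c :: 'k where "c = (-1) ^ (n + 1)"
  have "delR n (Delta d dV n f) = (\<lambda>xs. scaleV c (ceR (Delta d dV n f) xs))"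
    unfolding c_def by (rule delR_eq[OF Delta_in[OF f]])
  moreover have "delR n f = (\<lambda>xs. scaleV c (ceR f xs))"
    unfolding c_def by (rule delR_eq[OF f])
  moreover have "ceR (\<lambda>ys. - dact f ys) xs = - ceR (dact f) xs" for xs
    using twisted.ce_scale[of "-1" "dact f" xs] by (simp add: V.scale_minus_left)
  ultimately show ?thesis
    using f Delta_eq[OF delR_in[OF f]]
    by (simp add: Delta_eq[OF f] induced_action_scale[OF dV_linear] dact_ceR V.scale_minus_right cochains_iff)
qed

lemma Delta_Phi:
  assumes f: "f \<in> C n" and n: "n \<ge> 1"
  shows "Delta d dV n (Phi n f) = Phi n (Delta d dV n f)"
proof -
  have alt: "alternating f" using f by (simp add: cochains_iff)
  have "Phi n (Delta d dV n f) = rmap (\<lambda>ys. - dact f ys)"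
    using phi_eq[OF Delta_in[OF f] n] by (simp add: Delta_eq[OF f])
  moreover have "rmap (\<lambda>ys. - dact f ys) xs = - rmap (dact f) xs" for xs
    using rmap_scale[of "-1" "dact f" xs] by (simp add: V.scale_minus_left)
  moreover have "Delta d dV n (Phi n f) = (\<lambda>xs. - dact (rmap f) xs)"
    using Delta_eq[OF Phi_in[OF f n]] by (simp add: phi_eq[OF f n])
  ultimately show ?thesis by (simp add: dact_rmap[OF alt] fun_eq_iff)
qed

lemma delR_add: "delR n (f + g) = delR n f + delR n g"
  unfolding delta_R_def by (rule twisted.delta_CE_add)

lemma delR_scale: "delR n (\<lambda>xs. scaleV c (f xs)) = (\<lambda>xs. scaleV c (delR n f xs))"
  unfolding delta_R_def by (rule twisted.delta_CE_scale)

lemma Phi_add: "Phi n (f + g) = Phi n f + Phi n g"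
  by (rule ext) (simp add: phi_def action_simps V.scale_right_distrib sum.distrib)

lemma Phi_scale: "Phi n (\<lambda>xs. scaleV c (f xs)) = (\<lambda>xs. scaleV c (Phi n f xs))"
  by (rule ext) (simp add: phi_def action_simps V.scale_right_distrib V.scale_right_diff_distrib
      mult.commute flip: V.scale_sum_right)

lemma Delta_add: "Delta d dV n (f + g) = Delta d dV n f + Delta d dV n g"
  by (rule ext) (simp add: Delta_def lin_add[OF dV_linear] sum.distrib)

lemma Delta_scale: "Delta d dV n (\<lambda>xs. scaleV c (f xs)) = (\<lambda>xs. scaleV c (Delta d dV n f xs))"
  by (rule ext) (simp add: Delta_def lin_scale[OF dV_linear] V.scale_right_diff_distrib V.scale_sum_right)

section \<open>The total complex\<close>

abbreviation DR :: "nat \<Rightarrow> ('l, 'v) cochain_R \<Rightarrow> ('l, 'v) cochain_R" where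
  "DR \<equiv> D_R scaleV br R rho RV"

abbreviation CR :: "nat \<Rightarrow> ('l, 'v) cochain_R set" where
  "CR \<equiv> cochains_R scaleL scaleV"

lemma DR_add: "DR n (p + q) = DR n p + DR n q"
  by (simp add: D_R_def split_beta prod_eq_iff delta_CE_add delR_add Phi_add)

lemma DR_scale: "DR n (scale_R scaleV c p) = scale_R scaleV c (DR n p)"
  by (simp add: D_R_def scale_R_def split_beta delta_CE_scale delR_scale Phi_scale fun_eq_iff
      V.scale_right_diff_distrib V.scale_minus_right)

lemma Delta_R_add: "Delta_R d dV n (p + q) = Delta_R d dV n p + Delta_R d dV n q"
  by (simp add: Delta_R_def split_beta prod_eq_iff Delta_add)

lemma Delta_R_scale: "Delta_R d dV n (scale_R scaleV c p) = scale_R scaleV c (Delta_R d dV n p)"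
  by (simp add: Delta_R_def scale_R_def split_beta Delta_scale)

lemma vector_space_scale_R: "vector_space (scale_R scaleV)"
  by unfold_locales (auto simp: scale_R_def split_beta prod_eq_iff fun_eq_iff V.scale_right_distrib
      V.scale_left_distrib)

lemma scale_R_uminus: "scale_R scaleV (-1) p = - p"
  by (simp add: scale_R_def split_beta prod_eq_iff fun_eq_iff V.scale_minus_left)

lemma CR_zero: "0 \<in> CR n"
  and CR_add: "p \<in> CR n \<Longrightarrow> q \<in> CR n \<Longrightarrow> p + q \<in> CR n"
  and CR_scale: "p \<in> CR n \<Longrightarrow> scale_R scaleV c p \<in> CR n"
  by (auto simp: cochains_R_def scale_R_def split_beta mem_Times_iff C_zero C_add C_scale)

lemma CR_uminus: "p \<in> CR n \<Longrightarrow> - p \<in> CR n"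
  using CR_scale[of p n "-1"] by (simp only: scale_R_uminus)

lemma DR_uminus: "DR n (- p) = - DR n p"
  using DR_scale[of n "-1" p] by (simp only: scale_R_uminus)

lemma DR_in: "n \<ge> 1 \<Longrightarrow> p \<in> CR n \<Longrightarrow> DR n p \<in> CR (n + 1)"
  using delR_in[of "snd p" "n - 1"]
  by (simp add: cochains_R_def D_R_def split_beta mem_Times_iff delCE_in[simplified] C_diff C_uminus Phi_in)

lemma Delta_R_in: "p \<in> CR n \<Longrightarrow> Delta_R d dV n p \<in> CR n"
  by (simp add: cochains_R_def Delta_R_def split_beta mem_Times_iff Delta_in)

lemma DR_DR:
  assumes "n \<ge> 1" and "p \<in> CR n"
  shows "DR (n + 1) (DR n p) = 0"
proof -
  obtain f g where p: "p = (f, g)" by force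
  have f: "f \<in> C n" and g: "g \<in> C (n - 1)" using assms p by (auto simp: cochains_R_def)
  have n: "n - 1 + 1 = n" using assms by simp
  let ?a = "delR (n - 1) g" and ?b = "Phi n f"
  have "- ?a - ?b = (\<lambda>xs. scaleV (-1) ((?a + ?b) xs))"
    by (simp add: fun_eq_iff V.scale_minus_left)
  then have "delR n (- ?a - ?b) = (\<lambda>xs. scaleV (-1) (delR n (?a + ?b) xs))"
    by (simp only: delR_scale)
  also have "\<dots> = - delR n ?a - delR n ?b"
    by (simp add: delR_add fun_eq_iff V.scale_minus_left)
  also have "delR n ?a = 0"
    using delR_delR[OF g] unfolding n .
  finally have "delR n (- ?a - ?b) = - 0 - delR n ?b" .
  moreover have "DR (n + 1) (DR n p) = (delCE (n + 1) (delCE n f), - delR n (- ?a - ?b) - Phi (n + 1) (delCE n f))"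
    by (simp add: p D_R_def)
  ultimately show ?thesis
    unfolding delCE_delCE[OF f] delR_Phi[OF f assms(1)] by (simp only:) (simp add: zero_prod_def)
qed

lemma Delta_R_DR:
  assumes "n \<ge> 1" and "p \<in> CR n"
  shows "Delta_R d dV (n + 1) (DR n p) = DR n (Delta_R d dV n p)"
proof -
  obtain f g where p: "p = (f, g)" by force
  have f: "f \<in> C n" and g: "g \<in> C (n - 1)" using assms p by (auto simp: cochains_R_def)
  have n: "n - 1 + 1 = n" using assms by simp
  let ?a = "delR (n - 1) g" and ?b = "Phi n f"
  have "- ?a - ?b = (\<lambda>xs. scaleV (-1) ((?a + ?b) xs))"
    by (simp add: fun_eq_iff V.scale_minus_left)
  then have "Delta d dV n (- ?a - ?b) = (\<lambda>xs. scaleV (-1) (Delta d dV n (?a + ?b) xs))"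
    by (simp only: Delta_scale)
  also have "\<dots> = - Delta d dV n ?a - Delta d dV n ?b"
    by (simp add: Delta_add fun_eq_iff V.scale_minus_left)
  also have "Delta d dV n ?a = delR (n - 1) (Delta d dV (n - 1) g)"
    using Delta_delR[OF g] unfolding n .
  finally have "Delta d dV n (- ?a - ?b)
      = - delR (n - 1) (Delta d dV (n - 1) g) - Phi n (Delta d dV n f)"
    unfolding Delta_Phi[OF f assms(1)] .
  moreover have "Delta_R d dV (n + 1) (DR n p) = (Delta d dV (n + 1) (delCE n f), Delta d dV n (- ?a - ?b))"
    by (simp add: p D_R_def Delta_R_def)
  moreover have "DR n (Delta_R d dV n p) = (delCE n (Delta d dV n f),
      - delR (n - 1) (Delta d dV (n - 1) g) - Phi n (Delta d dV n f))"
    by (simp add: p D_R_def Delta_R_def)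
  ultimately show ?thesis unfolding Delta_delCE[OF f] by (simp only:)
qed

end

theorem theorem3p3:
  fixes scaleL :: "'k::field \<Rightarrow> 'l::ab_group_add \<Rightarrow> 'l"
    and br :: "'l \<Rightarrow> 'l \<Rightarrow> 'l"
    and R d :: "'l \<Rightarrow> 'l"
    and scaleV :: "'k \<Rightarrow> 'v::ab_group_add \<Rightarrow> 'v"
    and rho :: "'l \<Rightarrow> 'v \<Rightarrow> 'v"
    and RV dV :: "'v \<Rightarrow> 'v"
  assumes "reynolds_lieder_pair scaleL br R d"
    and "reynolds_lieder_representation scaleL br R d scaleV rho RV dV"
  shows "cochain_complex (scale_RLieDer scaleV)
           (cochains_RLieDer scaleL scaleV) (D_RLieDer scaleV br R d rho RV dV)"
proof -
  interpret reynolds_lieder_representation scaleL br R d scaleV rho RV dV by fact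
  interpret S: vector_space "scale_R scaleV" by (rule vector_space_scale_R)
  let ?C = "cochains_RLieDer scaleL scaleV"
  let ?D = "D_RLieDer scaleV br R d rho RV dV"
  interpret T: vector_space "scale_RLieDer scaleV"
    by unfold_locales (auto simp: scale_RLieDer_def split_beta prod_eq_iff
        S.scale_right_distrib S.scale_left_distrib simp flip: S.scale_scale)
  show ?thesis
  proof unfold_locales
    fix n :: nat assume n: "n \<ge> 1"
    show "T.subspace (?C n)"
      by (rule T.subspaceI; cases "n = 1") (simp_all add: cochains_RLieDer_def scale_RLieDer_def
          split_beta mem_Times_iff CR_zero CR_add CR_scale)
    fix c :: "('l, 'v) cochain_RLieDer" assume c: "c \<in> ?C n"
    show "?D n (c + c') = ?D n c + ?D n c'" for c'
      by (simp add: D_RLieDer_def split_beta prod_eq_iff DR_add Delta_R_add S.scale_right_distrib)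
    show "?D n (scale_RLieDer scaleV a c) = scale_RLieDer scaleV a (?D n c)" for a
      by (simp add: D_RLieDer_def scale_RLieDer_def split_beta DR_scale Delta_R_scale
          S.scale_right_distrib mult.commute)
    show "?D n c \<in> ?C (n + 1)"
      using n c DR_in[of "n - 1" "snd c"]
      by (auto simp: D_RLieDer_def cochains_RLieDer_def split_beta mem_Times_iff DR_in[simplified]
          Delta_R_in CR_add CR_scale CR_uminus)
    show "?D (n + 1) (?D n c) = 0"
    proof (cases "n = 1")
      case True
      then show ?thesis
        using c DR_DR[of 1 "fst c"] Delta_R_DR[of 1 "fst c"]
        by (auto simp: D_RLieDer_def cochains_RLieDer_def split_beta prod_eq_iff DR_uminus)
    next
      case False
      then have p: "fst c \<in> CR n" and q: "snd c \<in> CR (n - 1)" and n1: "n - 1 \<ge> 1" "n - 1 + 1 = n"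
        using c n by (auto simp: cochains_RLieDer_def)
      have "DR n (DR (n - 1) (snd c)) = 0"
        using DR_DR[OF n1(1) q] unfolding n1 .
      then have "DR n (snd (?D n c)) = scale_R scaleV ((-1) ^ n) (Delta_R d dV (n + 1) (DR n (fst c)))"
        using False by (simp add: D_RLieDer_def split_beta DR_add DR_scale Delta_R_DR[OF n p, simplified])
      then show ?thesis
        using n False DR_DR[OF n p]
        by (simp add: D_RLieDer_def split_beta prod_eq_iff S.scale_minus_left)
    qed
  qed
qed

end
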